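(* Let $E$ be an ultrafilter over a set $J$, let $(\lambda_j)_{j\in J}$ be regular infinite cardinals, and suppose that the cofinality of the linear order $\prod_E \langle \lambda_j,\leq\rangle$ equals $\mu$. If $D$ is a $|J|^+$-complete ultrafilter which is $\lambda_j$-decomposable for every $j\in J$, then $D$ is $\mu$-decomposable.
   Context: An ultrafilter $D$ over a set $I$ is $\lambda$-decomposable (for an infinite cardinal $\lambda$) if there is a partition of $I$ into $\lambda$ sets such that the union of any fewer than $\lambda$ sets of the partition never belongs to $D$. $D$ is $\theta$-complete if it is closed under intersections of fewer than $\theta$ of its members. For an ultrafilter $E$ over $J$ and cardinals $\lambda_j$, $\prod_E\langle\lambda_j,\leq\rangle$ is the linear order on $\prod_{j\in J}\lambda_j$ modulo $E$, with $[f]_E\le[g]_E$ iff $\{j: f(j)\le g(j)\}\in E$. *)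

theory Defs
  imports Main "HOL-Library.FuncSet" "HOL-Library.Disjoint_Sets"
begin

unbundle cardinal_syntax

text \<open>
  Cardinals are represented as in the library, by well-orders \<^term>\<open>r\<close> with
  \<^term>\<open>Card_order r\<close>; the set underlying the cardinal is \<^term>\<open>Field r\<close>, the relation itself
  is its (reflexive) order, and cardinals on different types are compared by
  \<open>=o\<close>, \<open>\<le>o\<close>, \<open><o\<close>.
\<close>

definition ultrafilter_on :: "'i set \<Rightarrow> 'i set set \<Rightarrow> bool" where
  "ultrafilter_on I D \<longleftrightarrow>
     D \<subseteq> Pow I \<and> I \<in> D \<and> {} \<notin> D \<and>
     (\<forall>A\<in>D. \<forall>B\<in>D. A \<inter> B \<in> D) \<and>
     (\<forall>A\<in>D. \<forall>B. A \<subseteq> B \<and> B \<subseteq> I \<longrightarrow> B \<in> D) \<and>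
     (\<forall>A. A \<subseteq> I \<longrightarrow> A \<in> D \<or> I - A \<in> D)"

text \<open>Intersecting with \<^term>\<open>I\<close> only matters for the empty family, whose intersection is \<^term>\<open>I\<close>.\<close>

definition complete_ultrafilter :: "'k rel \<Rightarrow> 'i set \<Rightarrow> 'i set set \<Rightarrow> bool" where
  "complete_ultrafilter \<theta> I D \<longleftrightarrow>
     ultrafilter_on I D \<and> (\<forall>S. S \<subseteq> D \<and> |S| <o \<theta> \<longrightarrow> I \<inter> \<Inter>S \<in> D)"

text \<open>Decomposability is only defined for infinite cardinals.\<close>

definition decomposable :: "'k rel \<Rightarrow> 'i set \<Rightarrow> 'i set set \<Rightarrow> bool" where
  "decomposable \<kappa> I D \<longleftrightarrow>
     Cinfinite \<kappa> \<and>
     (\<exists>P. partition_on I P \<and> |P| =o \<kappa> \<and> (\<forall>Q. Q \<subseteq> P \<and> |Q| <o \<kappa> \<longrightarrow> \<Union>Q \<notin> D))"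

definition ultraprod_eq :: "'j set \<Rightarrow> 'j set set \<Rightarrow> ('j \<Rightarrow> 'a rel) \<Rightarrow> ('j \<Rightarrow> 'a) rel" where
  "ultraprod_eq J E r =
     {(f, g). f \<in> (\<Pi>\<^sub>E j\<in>J. Field (r j)) \<and> g \<in> (\<Pi>\<^sub>E j\<in>J. Field (r j)) \<and>
              {j \<in> J. f j = g j} \<in> E}"

text \<open>
  The order on the ultraproduct. The class of \<open>f\<close> modulo \<open>E\<close> is \<open>ultraprod_eq J E r `` {f}\<close>.
\<close>

definition ultraprod_le :: "'j set \<Rightarrow> 'j set set \<Rightarrow> ('j \<Rightarrow> 'a rel) \<Rightarrow> ('j \<Rightarrow> 'a) set rel" where
  "ultraprod_le J E r =
     {(ultraprod_eq J E r `` {f}, ultraprod_eq J E r `` {g}) | f g.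
        f \<in> (\<Pi>\<^sub>E j\<in>J. Field (r j)) \<and> g \<in> (\<Pi>\<^sub>E j\<in>J. Field (r j)) \<and>
        {j \<in> J. (f j, g j) \<in> r j} \<in> E}"

text \<open>
  Cofinality of a reflexive order \<open>L\<close>: the least cardinality of a cofinal subset. Cofinal is meant
  in the weak sense here, unlike the library's \<^const>\<open>cofinal\<close>, which asks for strictly larger
  elements.
\<close>

definition cofinal_subset :: "'b set \<Rightarrow> 'b rel \<Rightarrow> bool" where
  "cofinal_subset K L \<longleftrightarrow> K \<subseteq> Field L \<and> (\<forall>a\<in>Field L. \<exists>b\<in>K. (a, b) \<in> L)"

definition has_cofinality :: "'b rel \<Rightarrow> 'c rel \<Rightarrow> bool" where
  "has_cofinality L \<mu> \<longleftrightarrow>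
     Card_order \<mu> \<and>
     (\<exists>K. cofinal_subset K L \<and> |K| =o \<mu>) \<and>
     (\<forall>K. cofinal_subset K L \<longrightarrow> \<mu> \<le>o |K| )"

end

(* A function f from I to lam is D-unbounded if each of its values lies strictly above any given
   ordinal for D-almost all i. Decomposability yields such a function for each lam j, and
   |J|^+-completeness makes the classes of i |-> (f j i)_j a D-unbounded family c in the
   ultraproduct. If K is cofinal of cardinality mu, choose h i in K above c i. A subset B of K of
   cardinality less than mu is not cofinal, so some a lies below no element of B; as h i is above a
   for D-almost all i, the preimage of B under h is not in D. Hence the fibres of h decompose D. *)

theory Submission
  imports Defs
begin

section \<open>Ultrafilters and completeness\<close>

lemma ultrafilter_on_mono:
  "ultrafilter_on I D \<Longrightarrow> A \<in> D \<Longrightarrow> A \<subseteq> B \<Longrightarrow> B \<subseteq> I \<Longrightarrow> B \<in> D"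
  unfolding ultrafilter_on_def by blast

lemma ultrafilter_on_Int:
  "ultrafilter_on I D \<Longrightarrow> A \<in> D \<Longrightarrow> B \<in> D \<Longrightarrow> A \<inter> B \<in> D"
  unfolding ultrafilter_on_def by blast

lemma ultrafilter_on_disjoint:
  "ultrafilter_on I D \<Longrightarrow> A \<in> D \<Longrightarrow> A \<inter> B = {} \<Longrightarrow> B \<notin> D"
  unfolding ultrafilter_on_def by metis

lemma ultrafilter_on_finite_Inter:
  assumes "ultrafilter_on I D" "finite K" "\<And>k. k \<in> K \<Longrightarrow> {i \<in> I. P k i} \<in> D"
  shows "{i \<in> I. \<forall>k\<in>K. P k i} \<in> D"
  using assms(2,3)
proof (induction K)
  case empty
  then show ?case using assms(1) unfolding ultrafilter_on_def by simp
next
  case (insert k K)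
  have "{i \<in> I. P k i} \<inter> {i \<in> I. \<forall>k\<in>K. P k i} \<in> D"
    using insert by (intro ultrafilter_on_Int[OF assms(1)]) auto
  also have "{i \<in> I. P k i} \<inter> {i \<in> I. \<forall>k\<in>K. P k i} = {i \<in> I. \<forall>k\<in>insert k K. P k i}"
    by auto
  finally show ?case .
qed

text \<open>The family indexed by \<open>J\<close> has at most |J| distinct members, hence fewer
  than the successor cardinal. Completeness enters the whole proof only here.\<close>

lemma complete_ultrafilter_all:
  assumes "complete_ultrafilter (cardSuc |J| ) I D" "\<And>j. j \<in> J \<Longrightarrow> {i \<in> I. P j i} \<in> D"
  shows "{i \<in> I. \<forall>j\<in>J. P j i} \<in> D"
proof -
  let ?S = "(\<lambda>j. {i \<in> I. P j i}) ` J"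
  have "|?S| <o cardSuc |J|"
    using card_of_image cardSuc_greater[OF card_of_Card_order] ordLeq_ordLess_trans by blast
  moreover have "?S \<subseteq> D" using assms(2) by blast
  ultimately have "I \<inter> \<Inter>?S \<in> D"
    using assms(1) unfolding complete_ultrafilter_def by blast
  moreover have "I \<inter> \<Inter>?S = {i \<in> I. \<forall>j\<in>J. P j i}" by auto
  ultimately show ?thesis by simp
qed

section \<open>Decompositions and maps into a cardinal\<close>

lemma card_of_under_less:
  assumes "Cinfinite r" "a \<in> Field r"
  shows "|under r a| <o r"
proof -
  have r: "Card_order r" "infinite (Field r)" using assms(1) by (auto simp: cinfinite_def)
  \<comment> \<open>An infinite cardinal has no largest element, so the segment up to and including
    \<open>a\<close> lies in the open segment below some \<open>b\<close>, and open segments of a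
    cardinal are smaller than it.\<close>
  obtain b where b: "b \<in> Field r" "a \<noteq> b" "(a, b) \<in> r"
    using infinite_Card_order_limit[OF r assms(2)] by blast
  have "trans r" "antisym r" using r(1) by (simp_all add: card_order_on_def order_on_defs)
  then have "under r a \<subseteq> underS r b"
    using b unfolding under_def underS_def by (auto dest: transD antisymD)
  then show ?thesis
    using card_of_mono1 card_of_underS[OF r(1) b(1)] ordLeq_ordLess_trans by blast
qed

text \<open>Index the pieces by \<open>Field r\<close> and send \<open>i\<close> to the index of its
  piece. Values at most \<open>a\<close> occur only on a union of fewer than \<open>r\<close>
  pieces, which is not in \<open>D\<close>; so the complement is in \<open>D\<close>, and totality
  of \<open>r\<close> makes it the set of values strictly above \<open>a\<close>.\<close>

lemma decomposable_unbounded_map: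
  assumes D: "ultrafilter_on I D" and "decomposable r I D"
  obtains f where "\<And>i. i \<in> I \<Longrightarrow> f i \<in> Field r"
    "\<And>a. a \<in> Field r \<Longrightarrow> {i \<in> I. (a, f i) \<in> r \<and> (f i, a) \<notin> r} \<in> D"
proof -
  obtain P where r: "Cinfinite r" and P: "partition_on I P" "|P| =o r"
    and small: "\<And>Q. Q \<subseteq> P \<Longrightarrow> |Q| <o r \<Longrightarrow> \<Union>Q \<notin> D"
    using assms(2) unfolding decomposable_def by blast
  have total: "(x, y) \<in> r \<or> (y, x) \<in> r" if "x \<in> Field r" "y \<in> Field r" for x y
    using r that wo_rel.TOTALS[unfolded wo_rel_def] by (auto simp: card_order_on_def)
  have "|P| =o |Field r|"
    using P(2) card_of_Field_ordIso r ordIso_symmetric ordIso_transitive by blast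
  then obtain b where b: "bij_betw b P (Field r)"
    using card_of_ordIso by blast
  have "\<exists>p. i \<in> I \<longrightarrow> p \<in> P \<and> i \<in> p" for i
    using partition_onD1[OF P(1)] by blast
  then obtain p where p: "\<And>i. i \<in> I \<Longrightarrow> p i \<in> P \<and> i \<in> p i" by metis
  show thesis
  proof (rule that)
    show f: "b (p i) \<in> Field r" if "i \<in> I" for i
      using p[OF that] b by (auto simp: bij_betw_def)
    fix a assume a: "a \<in> Field r"
    let ?Q = "{q \<in> P. b q \<in> under r a}"
    let ?A = "{i \<in> I. (b (p i), a) \<in> r}"
    have "inj_on b ?Q" using b by (auto simp: bij_betw_def inj_on_def)
    then have "|?Q| \<le>o |under r a|" using card_of_ordLeq by blast
    then have "\<Union>?Q \<notin> D"
      using card_of_under_less[OF r a] small[of ?Q] ordLeq_ordLess_trans by blast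
    moreover have "?A \<subseteq> \<Union>?Q" using p unfolding under_def by blast
    moreover have "\<Union>?Q \<subseteq> I" using partition_onD1[OF P(1)] by blast
    ultimately have "?A \<notin> D" using ultrafilter_on_mono[OF D] by blast
    moreover have "?A \<subseteq> I" by blast
    ultimately have "I - ?A \<in> D" using D unfolding ultrafilter_on_def by blast
    moreover have "I - ?A = {i \<in> I. (a, b (p i)) \<in> r \<and> (b (p i), a) \<notin> r}"
      using total[OF a f] by auto
    ultimately show "{i \<in> I. (a, b (p i)) \<in> r \<and> (b (p i), a) \<notin> r} \<in> D" by simp
  qed
qed

text \<open>A converse: the pieces are the fibres of \<open>h\<close>. Only fibres over the range of
  \<open>h\<close> are taken, since a partition has no empty pieces; what then needs proof is that
  there are still \<open>r\<close> of them.\<close>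

lemma decomposable_by_map:
  assumes r: "Cinfinite r" and K: "|K| =o r" and I: "I \<in> D"
    and h: "\<And>i. i \<in> I \<Longrightarrow> h i \<in> K"
    and small: "\<And>B. B \<subseteq> K \<Longrightarrow> |B| <o r \<Longrightarrow> {i \<in> I. h i \<in> B} \<notin> D"
  shows "decomposable r I D"
proof -
  define F where "F k = {i \<in> I. h i = k}" for k
  have inj: "inj_on F (h ` I)" unfolding F_def inj_on_def by blast
  have "partition_on I (F ` h ` I)"
    unfolding partition_on_def disjoint_def F_def by auto
  moreover have "|F ` h ` I| =o r"
  proof -
    have hI: "h ` I \<subseteq> K" using h by blast
    have "{i \<in> I. h i \<in> h ` I} = I" by auto
    \<comment> \<open>The preimage of the range is all of \<open>I\<close>, which lies in
      \<open>D\<close>, so the range cannot be small.\<close>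
    then have "\<not> |h ` I| <o r" using small[OF hI] I by auto
    moreover have "|h ` I| \<le>o r"
      using card_of_mono1[OF hI] K ordLeq_ordIso_trans by blast
    ultimately have "|h ` I| =o r" using ordLeq_iff_ordLess_or_ordIso by blast
    moreover have "|h ` I| =o |F ` h ` I|"
      using inj card_of_ordIso inj_on_imp_bij_betw by blast
    ultimately show ?thesis using ordIso_symmetric ordIso_transitive by blast
  qed
  moreover have "\<Union>Q \<notin> D" if Q: "Q \<subseteq> F ` h ` I" "|Q| <o r" for Q
  proof -
    \<comment> \<open>Passing to a set \<open>B\<close> of values in bijection with \<open>Q\<close>
      carries the cardinality bound from fibres to values.\<close>
    obtain B where B: "B \<subseteq> h ` I" "inj_on F B" "Q = F ` B"
      using subset_image_inj[THEN iffD1, OF Q(1)] by blast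
    then have "|B| =o |Q|" using card_of_ordIso inj_on_imp_bij_betw by blast
    then have "|B| <o r" using Q(2) ordIso_ordLess_trans by blast
    moreover have "B \<subseteq> K" using B(1) h by blast
    moreover have "\<Union>Q = {i \<in> I. h i \<in> B}" unfolding B(3) F_def by blast
    ultimately show ?thesis using small by simp
  qed
  ultimately show ?thesis unfolding decomposable_def using r by blast
qed

section \<open>The order on the ultraproduct\<close>

lemma ultraprod_eq_class_iff:
  assumes E: "ultrafilter_on J E" and "f \<in> (\<Pi>\<^sub>E j\<in>J. Field (r j))"
    and g: "g \<in> (\<Pi>\<^sub>E j\<in>J. Field (r j))"
    and eq: "ultraprod_eq J E r `` {f} = ultraprod_eq J E r `` {g}"
  shows "{j \<in> J. f j = g j} \<in> E"
proof -
  have "J \<in> E" using E unfolding ultrafilter_on_def by blast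
  \<comment> \<open>\<open>g\<close> lies in its own class, hence in the class of \<open>f\<close>,
    which by definition means agreement on a set in \<open>E\<close>.\<close>
  then have "g \<in> ultraprod_eq J E r `` {g}" using g by (simp add: ultraprod_eq_def)
  then show ?thesis unfolding eq[symmetric] by (simp add: ultraprod_eq_def)
qed

text \<open>The order does not depend on representatives: those witnessing
  \<open>ultraprod_le\<close> agree with \<open>f\<close> and \<open>g\<close> on sets in
  \<open>E\<close>, and intersecting these with the set where the witnesses compare transfers the
  comparison.\<close>

lemma ultraprod_le_class_iff:
  assumes E: "ultrafilter_on J E" and f: "f \<in> (\<Pi>\<^sub>E j\<in>J. Field (r j))"
    and g: "g \<in> (\<Pi>\<^sub>E j\<in>J. Field (r j))"
  shows "(ultraprod_eq J E r `` {f}, ultraprod_eq J E r `` {g}) \<in> ultraprod_le J E r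
    \<longleftrightarrow> {j \<in> J. (f j, g j) \<in> r j} \<in> E" (is "?L \<longleftrightarrow> ?R")
proof
  assume ?L
  then obtain f' g' where
    f': "f' \<in> (\<Pi>\<^sub>E j\<in>J. Field (r j))" "ultraprod_eq J E r `` {f} = ultraprod_eq J E r `` {f'}"
    and g': "g' \<in> (\<Pi>\<^sub>E j\<in>J. Field (r j))" "ultraprod_eq J E r `` {g} = ultraprod_eq J E r `` {g'}"
    and le: "{j \<in> J. (f' j, g' j) \<in> r j} \<in> E"
    unfolding ultraprod_le_def by auto
  have "{j \<in> J. f j = f' j} \<inter> {j \<in> J. g j = g' j} \<inter> {j \<in> J. (f' j, g' j) \<in> r j} \<in> E"
    using ultraprod_eq_class_iff[OF E f f'] ultraprod_eq_class_iff[OF E g g'] le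
    by (intro ultrafilter_on_Int[OF E])
  then show ?R by (rule ultrafilter_on_mono[OF E]) auto
next
  assume ?R
  then show ?L unfolding ultraprod_le_def using f g by blast
qed

text \<open>\<open>Field\<close> sees only elements of related pairs; coordinatewise reflexivity
  relates every class to itself.\<close>

lemma Field_ultraprod_le:
  assumes E: "ultrafilter_on J E" and r: "\<And>j. j \<in> J \<Longrightarrow> refl_on (Field (r j)) (r j)"
  shows "Field (ultraprod_le J E r) = (\<lambda>f. ultraprod_eq J E r `` {f}) ` (\<Pi>\<^sub>E j\<in>J. Field (r j))"
proof (intro equalityI subsetI)
  fix x assume "x \<in> Field (ultraprod_le J E r)"
  then show "x \<in> (\<lambda>f. ultraprod_eq J E r `` {f}) ` (\<Pi>\<^sub>E j\<in>J. Field (r j))"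
    unfolding Field_def ultraprod_le_def by auto
next
  fix x assume "x \<in> (\<lambda>f. ultraprod_eq J E r `` {f}) ` (\<Pi>\<^sub>E j\<in>J. Field (r j))"
  then obtain f where f: "f \<in> (\<Pi>\<^sub>E j\<in>J. Field (r j))" and x: "x = ultraprod_eq J E r `` {f}"
    by blast
  have "{j \<in> J. (f j, f j) \<in> r j} = J"
    using r f by (auto dest: refl_onD PiE_mem)
  moreover have "J \<in> E" using E unfolding ultrafilter_on_def by blast
  ultimately have "(x, x) \<in> ultraprod_le J E r"
    unfolding x ultraprod_le_class_iff[OF E f f] by simp
  then show "x \<in> Field (ultraprod_le J E r)" by (rule FieldI1)
qed

lemma trans_ultraprod_le:
  assumes E: "ultrafilter_on J E" and r: "\<And>j. j \<in> J \<Longrightarrow> trans (r j)"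
  shows "trans (ultraprod_le J E r)"
proof (rule transI)
  fix x y z assume xy: "(x, y) \<in> ultraprod_le J E r" and yz: "(y, z) \<in> ultraprod_le J E r"
  obtain f g where fg: "f \<in> (\<Pi>\<^sub>E j\<in>J. Field (r j))" "x = ultraprod_eq J E r `` {f}"
      "g \<in> (\<Pi>\<^sub>E j\<in>J. Field (r j))" "y = ultraprod_eq J E r `` {g}"
    using xy unfolding ultraprod_le_def by auto
  obtain h where h: "h \<in> (\<Pi>\<^sub>E j\<in>J. Field (r j))" "z = ultraprod_eq J E r `` {h}"
    using yz unfolding ultraprod_le_def by auto
  have "{j \<in> J. (f j, g j) \<in> r j} \<in> E" "{j \<in> J. (g j, h j) \<in> r j} \<in> E"
    using xy yz fg h by (simp_all add: ultraprod_le_class_iff[OF E])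
  then have "{j \<in> J. (f j, g j) \<in> r j} \<inter> {j \<in> J. (g j, h j) \<in> r j} \<in> E"
    by (rule ultrafilter_on_Int[OF E])
  then have "{j \<in> J. (f j, h j) \<in> r j} \<in> E"
    by (rule ultrafilter_on_mono[OF E]) (auto dest: transD[OF r])
  then show "(x, z) \<in> ultraprod_le J E r"
    using fg h by (simp add: ultraprod_le_class_iff[OF E])
qed

section \<open>From an unbounded family in a transitive relation to a decomposition\<close>

lemma decomposable_of_unbounded_map:
  assumes D: "ultrafilter_on I D" and L: "trans L" and cof: "has_cofinality L \<mu>"
    and c: "\<And>i. i \<in> I \<Longrightarrow> c i \<in> Field L"
    and unb: "\<And>a. a \<in> Field L \<Longrightarrow> {i \<in> I. (a, c i) \<in> L \<and> (c i, a) \<notin> L} \<in> D"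
  shows "decomposable \<mu> I D"
proof -
  obtain K where K: "cofinal_subset K L" "|K| =o \<mu>"
    and \<mu>: "Card_order \<mu>" and least: "\<And>B. cofinal_subset B L \<Longrightarrow> \<mu> \<le>o |B|"
    using cof unfolding has_cofinality_def by blast
  \<comment> \<open>Moving each \<open>c i\<close> up to a member of \<open>K\<close> keeps the
    family unbounded and confines its values to a set of cardinality \<open>\<mu>\<close>.\<close>
  have "\<exists>k. i \<in> I \<longrightarrow> k \<in> K \<and> (c i, k) \<in> L" for i
    using K(1) c unfolding cofinal_subset_def by blast
  then obtain h where h: "\<And>i. i \<in> I \<Longrightarrow> h i \<in> K \<and> (c i, h i) \<in> L" by metis
  \<comment> \<open>Decomposability demands an infinite \<open>\<mu>\<close>. Were \<open>K\<close>
    finite, finitely many sets in \<open>D\<close> would meet in a set of \<open>i\<close> with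
    \<open>c i\<close> below no member of \<open>K\<close>, contradicting the choice of
    \<open>h i\<close>.\<close>
  have "infinite K"
  proof
    assume "finite K"
    moreover have "{i \<in> I. (c i, k) \<notin> L} \<in> D" if "k \<in> K" for k
    proof (rule ultrafilter_on_mono[OF D])
      show "{i \<in> I. (k, c i) \<in> L \<and> (c i, k) \<notin> L} \<in> D"
        using K(1) that by (intro unb) (auto simp: cofinal_subset_def)
    qed auto
    ultimately have "{i \<in> I. \<forall>k\<in>K. (c i, k) \<notin> L} \<in> D"
      by (rule ultrafilter_on_finite_Inter[OF D])
    moreover have "{i \<in> I. \<forall>k\<in>K. (c i, k) \<notin> L} = {}" using h by blast
    ultimately show False using D unfolding ultrafilter_on_def by simp
  qed
  moreover have "|K| =o |Field \<mu>|"
    using K(2) card_of_Field_ordIso[OF \<mu>] ordIso_symmetric ordIso_transitive by blast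
  ultimately have "infinite (Field \<mu>)"
    using card_of_ordIso_finite by blast
  then have "Cinfinite \<mu>" using \<mu> by (simp add: cinfinite_def)
  moreover have "{i \<in> I. h i \<in> B} \<notin> D" if B: "B \<subseteq> K" "|B| <o \<mu>" for B
  proof -
    have "\<not> cofinal_subset B L" using least B(2) not_ordLess_ordLeq by blast
    then obtain a where a: "a \<in> Field L" "\<And>b. b \<in> B \<Longrightarrow> (a, b) \<notin> L"
      using K(1) B(1) unfolding cofinal_subset_def by blast
    \<comment> \<open>If \<open>a\<close> is below \<open>c i\<close>, it is below
      \<open>h i\<close> by transitivity, so \<open>h i\<close> cannot belong to
      \<open>B\<close>.\<close>
    have "{i \<in> I. (a, c i) \<in> L \<and> (c i, a) \<notin> L} \<inter> {i \<in> I. h i \<in> B} = {}"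
      using a(2) h transD[OF L] by blast
    then show ?thesis by (rule ultrafilter_on_disjoint[OF D unb[OF a(1)]])
  qed
  moreover have "I \<in> D" using D unfolding ultrafilter_on_def by blast
  ultimately show ?thesis using decomposable_by_map[OF _ K(2)] h by blast
qed

theorem theorem2p1:
  fixes J :: "'j set" and E :: "'j set set"
    and lam :: "'j \<Rightarrow> 'a rel" and \<mu> :: "'c rel"
    and I :: "'i set" and D :: "'i set set"
  assumes "ultrafilter_on J E"
    and "\<And>j. j \<in> J \<Longrightarrow> Cinfinite (lam j) \<and> regularCard (lam j)"
    and "has_cofinality (ultraprod_le J E lam) \<mu>"
    and "ultrafilter_on I D"
    and "complete_ultrafilter (cardSuc |J| ) I D"
    and "\<And>j. j \<in> J \<Longrightarrow> decomposable (lam j) I D"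
  shows "decomposable \<mu> I D"
proof -
  note E = assms(1) and D = assms(4)
  have wo: "Well_order (lam j)" if "j \<in> J" for j
    using assms(2)[OF that] by (simp add: card_order_on_def)
  have refl: "refl_on (Field (lam j)) (lam j)" and trans: "trans (lam j)" if "j \<in> J" for j
    using wo[OF that] by (simp_all add: order_on_defs)
  have "\<exists>f. (\<forall>i\<in>I. f i \<in> Field (lam j)) \<and>
      (\<forall>a\<in>Field (lam j). {i \<in> I. (a, f i) \<in> lam j \<and> (f i, a) \<notin> lam j} \<in> D)"
    if j: "j \<in> J" for j
  proof -
    obtain f where "\<And>i. i \<in> I \<Longrightarrow> f i \<in> Field (lam j)"
      "\<And>a. a \<in> Field (lam j) \<Longrightarrow> {i \<in> I. (a, f i) \<in> lam j \<and> (f i, a) \<notin> lam j} \<in> D"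
      using D assms(6)[OF j] by (rule decomposable_unbounded_map) blast
    then show ?thesis by (intro exI[of _ f]) simp
  qed
  then have "\<exists>f. \<forall>j\<in>J. (\<forall>i\<in>I. f j i \<in> Field (lam j)) \<and>
      (\<forall>a\<in>Field (lam j). {i \<in> I. (a, f j i) \<in> lam j \<and> (f j i, a) \<notin> lam j} \<in> D)"
    by (intro bchoice ballI)
  then obtain f where f: "\<And>j i. j \<in> J \<Longrightarrow> i \<in> I \<Longrightarrow> f j i \<in> Field (lam j)"
    and unb: "\<And>j a. j \<in> J \<Longrightarrow> a \<in> Field (lam j) \<Longrightarrow>
      {i \<in> I. (a, f j i) \<in> lam j \<and> (f j i, a) \<notin> lam j} \<in> D"
    by auto
  \<comment> \<open>The candidate family: \<open>F i\<close> collects the values at \<open>i\<close>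
    of all the coordinate maps, restricted to \<open>J\<close> because the product consists of
    extensional functions.\<close>
  define F where "F i = (\<lambda>j\<in>J. f j i)" for i
  have F: "F i \<in> (\<Pi>\<^sub>E j\<in>J. Field (lam j))" if "i \<in> I" for i
    using f that unfolding F_def by auto
  let ?cls = "\<lambda>g. ultraprod_eq J E lam `` {g}" and ?L = "ultraprod_le J E lam"
  have Field: "Field ?L = ?cls ` (\<Pi>\<^sub>E j\<in>J. Field (lam j))"
    using E refl by (rule Field_ultraprod_le)
  show ?thesis
  proof (rule decomposable_of_unbounded_map[OF D _ assms(3), where c = "\<lambda>i. ?cls (F i)"])
    show "trans ?L" using E trans by (rule trans_ultraprod_le)
    show "?cls (F i) \<in> Field ?L" if "i \<in> I" for i
      using F[OF that] unfolding Field by blast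
    fix a assume "a \<in> Field ?L"
    then obtain g where g: "g \<in> (\<Pi>\<^sub>E j\<in>J. Field (lam j))" and a: "a = ?cls g"
      unfolding Field by blast
    \<comment> \<open>Each coordinate of \<open>g\<close> is exceeded for almost all
      \<open>i\<close>; completeness gives one set in \<open>D\<close> on which all coordinates are
      exceeded at once.\<close>
    have "{i \<in> I. \<forall>j\<in>J. (g j, f j i) \<in> lam j \<and> (f j i, g j) \<notin> lam j} \<in> D"
      using g by (intro complete_ultrafilter_all[OF assms(5)] unb) auto
    then show "{i \<in> I. (a, ?cls (F i)) \<in> ?L \<and> (?cls (F i), a) \<notin> ?L} \<in> D"
    proof (rule ultrafilter_on_mono[OF D])
      show "{i \<in> I. \<forall>j\<in>J. (g j, f j i) \<in> lam j \<and> (f j i, g j) \<notin> lam j}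
        \<subseteq> {i \<in> I. (a, ?cls (F i)) \<in> ?L \<and> (?cls (F i), a) \<notin> ?L}"
      proof clarify
        fix i assume i: "i \<in> I"
          and above: "\<forall>j\<in>J. (g j, f j i) \<in> lam j \<and> (f j i, g j) \<notin> lam j"
        \<comment> \<open>Strictness at every coordinate makes the two comparison sets
          \<open>J\<close> and \<open>{}\<close>, so the classes compare strictly too.\<close>
        have "{j \<in> J. (g j, F i j) \<in> lam j} = J" "{j \<in> J. (F i j, g j) \<in> lam j} = {}"
          using above unfolding F_def by auto
        moreover have "J \<in> E" "{} \<notin> E" using E unfolding ultrafilter_on_def by blast+
        ultimately show "(a, ?cls (F i)) \<in> ?L \<and> (?cls (F i), a) \<notin> ?L"
          unfolding a ultraprod_le_class_iff[OF E g F[OF i]] ultraprod_le_class_iff[OF E F[OF i] g]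
          by (simp only: simp_thms)
      qed
    qed blast
  qed
qed

end
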